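(* Let $H$ be a finite simple graph whose edges are colored red and blue. Let $P$ be a maximum packing in $\mathcal F(H)$, let $uvx\in P$ be a triangle (with vertices $u,v,x$) whose red edge is $uv$, and let $uvy\in\mathcal F_P$. If $xy$ is a red edge of $H$ with $xy\notin R(P)$, then $uv$ is private in $\mathcal F_P$.
   Context: Graphs are finite and simple, and a triangle is identified with its set of three edges. For a family of triangles, a packing is a set of pairwise edge-disjoint members of the family; a maximum packing is one of largest size. For a graph $H$ whose edges are each colored red or blue, $\mathcal F(H)$ denotes the family of all triangles of $H$ with exactly one red edge (and hence two blue edges). For a packing $P$ in $\mathcal F(H)$, $R(P)$ and $B(P)$ denote the sets of red and blue edges, respectively, of the members of $P$. $H-X$ denotes $H$ with the edge set $X$ deleted (keeping the coloring of the remaining edges), and $\mathcal F_P=\mathcal F(H-B(P))$. An edge is private in a family of triangles if exactly one member of the family contains it. *)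

theory Defs
  imports Main "HOL-Library.Disjoint_Sets"
begin

datatype edge_color = Red | Blue

text \<open>
  An edge is the two-element set of its endpoints. The coloring is a total function on vertex
  sets, but only its values on the edges are ever used.
\<close>

record 'a colored_graph =
  verts :: "'a set"
  edges :: "'a set set"
  color :: "'a set \<Rightarrow> edge_color"

definition finite_simple_graph :: "'a colored_graph \<Rightarrow> bool" where
  "finite_simple_graph H \<longleftrightarrow>
     finite (verts H) \<and> (\<forall>e\<in>edges H. e \<subseteq> verts H \<and> card e = 2)"

definition delete_edges :: "'a colored_graph \<Rightarrow> 'a set set \<Rightarrow> 'a colored_graph" where
  "delete_edges H X = H\<lparr>edges := edges H - X\<rparr>"

definition triangle :: "'a \<Rightarrow> 'a \<Rightarrow> 'a \<Rightarrow> 'a set set" where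
  "triangle u v w = {{u, v}, {u, w}, {v, w}}"

definition triangles :: "'a colored_graph \<Rightarrow> 'a set set set" where
  "triangles H = {triangle u v w | u v w.
     u \<noteq> v \<and> u \<noteq> w \<and> v \<noteq> w \<and> triangle u v w \<subseteq> edges H}"

definition red_edges :: "'a colored_graph \<Rightarrow> 'a set set" where
  "red_edges H = {e \<in> edges H. color H e = Red}"

definition blue_edges :: "'a colored_graph \<Rightarrow> 'a set set" where
  "blue_edges H = {e \<in> edges H. color H e = Blue}"

definition one_red_triangles :: "'a colored_graph \<Rightarrow> 'a set set set"  (\<open>\<F>\<close>) where
  "\<F> H = {T \<in> triangles H. card (T \<inter> red_edges H) = 1}"

definition packing :: "'a set set set \<Rightarrow> 'a set set set \<Rightarrow> bool" where
  "packing Fam P \<longleftrightarrow> P \<subseteq> Fam \<and> disjoint P"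

text \<open>
  Sizes are compared by \<open>card\<close>, which is meaningful only for finite sets; the triangle
  families of a finite simple graph are finite.
\<close>

definition maximum_packing :: "'a set set set \<Rightarrow> 'a set set set \<Rightarrow> bool" where
  "maximum_packing Fam P \<longleftrightarrow> packing Fam P \<and> (\<forall>Q. packing Fam Q \<longrightarrow> card Q \<le> card P)"

definition packing_red :: "'a colored_graph \<Rightarrow> 'a set set set \<Rightarrow> 'a set set" where
  "packing_red H P = \<Union>P \<inter> red_edges H"

definition packing_blue :: "'a colored_graph \<Rightarrow> 'a set set set \<Rightarrow> 'a set set" where
  "packing_blue H P = \<Union>P \<inter> blue_edges H"

definition residual_family :: "'a colored_graph \<Rightarrow> 'a set set set \<Rightarrow> 'a set set set" where
  "residual_family H P = \<F> (delete_edges H (packing_blue H P))"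

definition private_edge :: "'a set set set \<Rightarrow> 'a set \<Rightarrow> bool" where
  "private_edge Fam e \<longleftrightarrow> (\<exists>!T. T \<in> Fam \<and> e \<in> T)"

end

theory Submission
  imports Defs
begin

text \<open>
  If \<open>uvz\<close> is a second residual triangle on \<open>uv\<close>, exchanging \<open>uvx\<close> for the two edge-disjoint
  triangles \<open>uvz\<close> and \<open>xyu\<close> yields a larger packing.
\<close>

text \<open>Every edge has exactly two elements, and this forces the three vertices apart.\<close>

lemma triangle_iff_edges:
  assumes "finite_simple_graph H"
  shows "triangle u v w \<in> triangles H \<longleftrightarrow> triangle u v w \<subseteq> edges H"
proof
  assume "triangle u v w \<subseteq> edges H"
  moreover from this have "\<forall>e\<in>triangle u v w. card e = 2"
    using assms by (auto simp: finite_simple_graph_def)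
  hence "u \<noteq> v \<and> u \<noteq> w \<and> v \<noteq> w" by (auto simp: triangle_def)
  ultimately show "triangle u v w \<in> triangles H" unfolding triangles_def by blast
qed (auto simp: triangles_def)

lemma edge_distinct:
  assumes "finite_simple_graph H" "{u, v} \<in> edges H"
  shows "u \<noteq> v"
  using assms by (force simp: finite_simple_graph_def)

text \<open>Once \<open>{u, v}\<close> is red it is the single red edge allowed, so the cardinality
  condition in \<open>\<F>\<close> becomes a condition on the colors of the other two edges.\<close>

lemma one_red_triangle_iff:
  assumes H: "finite_simple_graph H" and red: "{u, v} \<in> red_edges H"
  shows "triangle u v w \<in> \<F> H \<longleftrightarrow> {u, w} \<in> blue_edges H \<and> {v, w} \<in> blue_edges H"
proof
  assume T: "triangle u v w \<in> \<F> H"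
  hence E: "{u, v} \<in> edges H" "{u, w} \<in> edges H" "{v, w} \<in> edges H"
    using triangle_iff_edges[OF H, of u v w] by (auto simp: one_red_triangles_def triangle_def)
  \<comment> \<open>Either equality would collapse the vertex \<open>w\<close> onto \<open>v\<close>
    or \<open>u\<close>, leaving a one-element edge.\<close>
  have ne: "{u, w} \<noteq> {u, v}" "{v, w} \<noteq> {u, v}"
    using E edge_distinct[OF H] by (auto simp: doubleton_eq_iff)
  obtain e where e: "triangle u v w \<inter> red_edges H = {e}"
    using T by (auto simp: one_red_triangles_def card_1_singleton_iff)
  have "{u, v} \<in> triangle u v w \<inter> red_edges H" using red by (simp add: triangle_def)
  hence "e = {u, v}" unfolding e by simp
  hence "triangle u v w \<inter> red_edges H = {{u, v}}" using e by simp
  moreover have "{u, w} \<in> triangle u v w" "{v, w} \<in> triangle u v w" by (simp_all add: triangle_def)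
  ultimately have "{u, w} \<notin> red_edges H \<and> {v, w} \<notin> red_edges H"
    using ne by (metis IntI singletonD)
  thus "{u, w} \<in> blue_edges H \<and> {v, w} \<in> blue_edges H"
    using E unfolding red_edges_def blue_edges_def mem_Collect_eq by (metis edge_color.exhaust)
next
  assume "{u, w} \<in> blue_edges H \<and> {v, w} \<in> blue_edges H"
  hence "triangle u v w \<inter> red_edges H = {{u, v}}" "triangle u v w \<subseteq> edges H"
    using red by (auto simp: triangle_def red_edges_def blue_edges_def)
  thus "triangle u v w \<in> \<F> H"
    using triangle_iff_edges[OF H] by (simp add: one_red_triangles_def)
qed

text \<open>Only blue edges are deleted, so the red edges of every surviving triangle are counted as
  before, and the triangles lost are those that use a deleted edge.\<close>

lemma residual_family_eq: "residual_family H P = {T \<in> \<F> H. T \<inter> packing_blue H P = {}}"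
proof -
  have "triangles (delete_edges H X) = {T \<in> triangles H. T \<inter> X = {}}" for X
    by (fastforce simp: triangles_def delete_edges_def)
  moreover have "red_edges (delete_edges H (packing_blue H P)) = red_edges H"
    by (auto simp: red_edges_def delete_edges_def packing_blue_def blue_edges_def)
  ultimately show ?thesis by (auto simp: residual_family_def one_red_triangles_def)
qed

lemma triangle_through_edge:
  assumes "T \<in> triangles H" "{u, v} \<in> T"
  obtains w where "T = triangle u v w"
proof -
  obtain a b c where T: "T = triangle a b c"
    using assms by (auto simp: triangles_def)
  from assms(2) consider "{u, v} = {a, b}" | "{u, v} = {a, c}" | "{u, v} = {b, c}"
    by (auto simp: T triangle_def)
  then show thesis
  proof cases
    case 1
    hence "T = triangle u v c" by (auto simp: T triangle_def doubleton_eq_iff)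
    thus thesis by (rule that)
  next
    case 2
    hence "T = triangle u v b" by (auto simp: T triangle_def doubleton_eq_iff)
    thus thesis by (rule that)
  next
    case 3
    hence "T = triangle u v a" by (auto simp: T triangle_def doubleton_eq_iff)
    thus thesis by (rule that)
  qed
qed

lemma finite_one_red_triangles:
  assumes "finite_simple_graph H"
  shows "finite (\<F> H)"
proof (rule finite_subset)
  show "\<F> H \<subseteq> Pow (Pow (verts H))"
    using assms by (fastforce simp: one_red_triangles_def triangles_def finite_simple_graph_def)
  show "finite (Pow (Pow (verts H)))"
    using assms by (simp add: finite_simple_graph_def)
qed

text \<open>The other members of \<open>P\<close> are disjoint from \<open>T\<close>. Sets
  \<open>A\<close> and \<open>B\<close> that meet the edges of \<open>P\<close> only inside
  \<open>T\<close> therefore avoid all of them, and replacing \<open>T\<close> by both gives a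
  packing with one more member.\<close>

lemma maximum_packing_no_exchange:
  assumes P: "maximum_packing Fam P" and fin: "finite Fam"
    and T: "T \<in> P" and A: "A \<in> Fam" "A \<noteq> {}" and B: "B \<in> Fam" "B \<noteq> {}" and "A \<inter> B = {}"
    and new: "A \<inter> \<Union>P \<subseteq> T" "B \<inter> \<Union>P \<subseteq> T"
  shows False
proof -
  let ?R = "P - {T}"
  have P': "P \<subseteq> Fam" "disjoint P" using P by (auto simp: maximum_packing_def packing_def)
  have "finite P" using P'(1) fin by (rule finite_subset)
  have apart: "A \<inter> S = {}" "B \<inter> S = {}" if "S \<in> ?R" for S
  proof -
    have "S \<inter> T = {}" using that T P'(2) by (auto simp: disjoint_def)
    thus "A \<inter> S = {}" "B \<inter> S = {}" using that new by blast+
  qed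
  have "packing Fam (insert A (insert B ?R))"
    unfolding packing_def
  proof
    show "insert A (insert B ?R) \<subseteq> Fam" using P' A B by blast
    show "disjoint (insert A (insert B ?R))"
    proof (rule disjointI)
      fix X Y assume "X \<in> insert A (insert B ?R)" "Y \<in> insert A (insert B ?R)" "X \<noteq> Y"
      thus "X \<inter> Y = {}"
        using apart[of X] apart[of Y] disjointD[OF P'(2), of X Y] \<open>A \<inter> B = {}\<close>
        by (elim insertE) (simp_all add: Int_commute)
    qed
  qed
  hence "card (insert A (insert B ?R)) \<le> card P" using P by (simp add: maximum_packing_def)
  \<comment> \<open>A set equal to one that it is disjoint from is empty, so nonemptiness makes both
    insertions genuinely new and the new packing has size \<open>card P + 1\<close>.\<close>
  moreover have "A \<notin> insert B ?R" "B \<notin> ?R" using apart A B \<open>A \<inter> B = {}\<close> by auto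
  ultimately show False
    using \<open>finite P\<close> T card_Suc_Diff1[OF \<open>finite P\<close> T] by simp
qed

theorem lemma2p1:
  fixes H :: "'a colored_graph" and P :: "'a set set set" and u v x y :: 'a
  assumes "finite_simple_graph H"
    and "maximum_packing (\<F> H) P"
    and "triangle u v x \<in> P"
    and "{u, v} \<in> red_edges H"
    and "triangle u v y \<in> residual_family H P"
    and "{x, y} \<in> red_edges H"
    and "{x, y} \<notin> packing_red H P"
  shows "private_edge (residual_family H P) {u, v}"
  unfolding private_edge_def
proof (rule ex1I[of _ "triangle u v y"])
  note H = assms(1) and red = assms(4)
  \<comment> \<open>A blue edge covered by \<open>P\<close> lies in \<open>packing_blue H P\<close>.
    The blue edges of a residual triangle avoid that set, so no member of \<open>P\<close> contains
    them.\<close>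
  have residual: "{u, w} \<in> blue_edges H" "{v, w} \<in> blue_edges H" "{u, w} \<notin> \<Union>P" "{v, w} \<notin> \<Union>P"
    if "triangle u v w \<in> residual_family H P" for w
  proof -
    have "triangle u v w \<in> \<F> H" "triangle u v w \<inter> packing_blue H P = {}"
      using that by (auto simp: residual_family_eq)
    with one_red_triangle_iff[OF H red, of w]
    show "{u, w} \<in> blue_edges H" "{v, w} \<in> blue_edges H" "{u, w} \<notin> \<Union>P" "{v, w} \<notin> \<Union>P"
      by (auto simp: packing_blue_def triangle_def)
  qed
  have "triangle u v x \<in> \<F> H"
    using assms(2,3) by (auto simp: maximum_packing_def packing_def)
  hence x: "{u, x} \<in> blue_edges H" using one_red_triangle_iff[OF H red] by simp
  have ux: "{u, x} \<in> \<Union>P" by (rule UnionI[OF assms(3)]) (simp add: triangle_def)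
  \<comment> \<open>As \<open>{x, y}\<close> is red, lying outside R(P) means being uncovered by
    \<open>P\<close> altogether.\<close>
  have xy: "{x, y} \<notin> \<Union>P" using assms(6,7) by (simp add: packing_red_def)
  show "triangle u v y \<in> residual_family H P \<and> {u, v} \<in> triangle u v y"
    using assms(5) by (simp add: triangle_def)
  fix T assume T: "T \<in> residual_family H P \<and> {u, v} \<in> T"
  hence "T \<in> triangles H" by (simp add: residual_family_eq one_red_triangles_def)
  with T obtain z where z: "T = triangle u v z" by (metis triangle_through_edge)
  note rz = residual[OF T[THEN conjunct1, unfolded z]] and ry = residual[OF assms(5)]
  show "T = triangle u v y"
  proof (rule ccontr)
    assume "T \<noteq> triangle u v y"
    hence "z \<noteq> y" using z by auto
    have edges: "{u, v} \<in> edges H" "{u, x} \<in> edges H" "{u, y} \<in> edges H" "{u, z} \<in> edges H" "{v, z} \<in> edges H"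
        "{v, y} \<in> edges H"
      using red x rz ry by (auto simp: red_edges_def blue_edges_def)
    \<comment> \<open>The edge \<open>{u, z}\<close> is uncovered by \<open>P\<close>, whereas
      \<open>{u, x}\<close> is covered by \<open>triangle u v x\<close>.\<close>
    have "z \<noteq> x" using rz(3) ux by auto
    show False
    proof (rule maximum_packing_no_exchange[OF assms(2) finite_one_red_triangles[OF H] assms(3)])
      show "triangle u v z \<in> \<F> H" using T z by (simp add: residual_family_eq)
      \<comment> \<open>The vertices are listed with the red edge \<open>{x, y}\<close> first, as
        \<open>one_red_triangle_iff\<close> expects; the remaining edges \<open>{x, u}\<close> and
        \<open>{y, u}\<close> are blue.\<close>
      show "triangle x y u \<in> \<F> H"
        using one_red_triangle_iff[OF H assms(6)] x ry(1) by (simp add: insert_commute)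
      \<comment> \<open>The edge \<open>{u, v}\<close> is red and \<open>{u, x}\<close> is blue.
        With this, \<open>u\<close> is the only common vertex of the two new triangles, so they
        share no edge.\<close>
      have "v \<noteq> x" using red x by (auto simp: red_edges_def blue_edges_def)
      thus "triangle u v z \<inter> triangle x y u = {}"
        using \<open>z \<noteq> y\<close> \<open>z \<noteq> x\<close> edges[THEN edge_distinct[OF H]]
        by (auto simp: triangle_def doubleton_eq_iff)
      \<comment> \<open>The only edge of \<open>triangle u v z\<close> that \<open>P\<close> covers
        is \<open>{u, v}\<close>; for \<open>triangle x y u\<close> it is \<open>{u, x}\<close>.
        Both belong to the triangle being removed.\<close>
      show "triangle u v z \<inter> \<Union>P \<subseteq> triangle u v x"
        using rz by (auto simp: triangle_def)
      show "triangle x y u \<inter> \<Union>P \<subseteq> triangle u v x"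
        using ry xy by (auto simp: triangle_def insert_commute)
    qed (simp_all add: triangle_def)
  qed
qed

end
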